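(* Let $(W,S)$ be a Coxeter system such that for some $y\in W$ we have $P_{x,y}=1$ for all $x\le y$, but $[1,y]_{\mathcal B}$ cannot be cubulated. Let $(W',S')$ be any Coxeter system which contains $(W,S)$ as a subsystem. Denote by $\le'$ the Bruhat order on $(W',S')$, by $\mathcal B'$ the Bruhat graph of $(W',S')$, and by $P'_{x',y'}$ the Kazhdan--Lusztig polynomial for $x',y'\in W'$. Then, regarding $y\in W$ as an element of $W'$, we have $P'_{x',y}=1$ for all $x'\in W'$ with $x'\le' y$, but $[1,y]_{\mathcal B'}$ cannot be cubulated. In particular, the implication "for every element $z$ of the group, if all Kazhdan--Lusztig polynomials indexed by $(x,z)$ with $x$ below $z$ in Bruhat order equal $1$, then the Bruhat graph for $[1,z]$ can be cubulated" also fails for any Coxeter system which has $(W,S)$ as a subsystem.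
   Context: Let $(W,S)$ be a Coxeter system with $S$ finite, word length $\ell$, set of reflections $\mathcal T=\{xsx^{-1}: x\in W, s\in S\}$, and Bruhat order $\le$ (generated by $x\le xt$ for $x\in W$, $t\in\mathcal T$, $\ell(xt)>\ell(x)$). For $x\le y$, $[x,y]=\{z\in W: x\le z\le y\}$. $(W,S)$ is a subsystem of $(W',S')$ if $S\subseteq S'$ and $W=\langle S\rangle\le W'$ is the standard parabolic subgroup generated by $S$. Bruhat graph: $\mathcal B$ is the directed graph with vertex set $W$ and an edge from $x$ to $xt$, for $t\in\mathcal T$, if and only if $\ell(xt)>\ell(x)$. The graph $[x,y]_{\mathcal B}$ is the subgraph of $\mathcal B$ induced by the vertex set $[x,y]$; similarly $[x',y']_{\mathcal B'}$ is the subgraph of $\mathcal B'$ induced by the Bruhat interval from $x'$ to $y'$ in $W'$. Cubical lattice: for an integer $N\ge 1$ and $k_1,\dots,k_N\in\mathbb N=\{0,1,2,\dots\}$, $\mathcal C(k_1,\dots,k_N)$ is the directed graph with vertex set $\{(m_1,\dots,m_N)\in\mathbb Z^N: 0\le m_i\le k_i \text{ for all } i\}$ and an edge from $u$ to $v$ if and only if $v-u$ is a standard basis vector of $\mathbb Z^N$. A cubical lattice is any directed graph isomorphic to some $\mathcal C(k_1,\dots,k_N)$. Cubulation: a directed graph $\mathcal D$ can be cubulated if some cubical lattice is isomorphic to a spanning subgraph of $\mathcal D$ (a subgraph, not necessarily induced, with the same vertex set as $\mathcal D$). The Kazhdan--Lusztig polynomials $P_{x,y}=P_{x,y}(q)\in\mathbb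 Z[q]$ are in the standard (original) normalization: $P_{x,y}=0$ if $x\not\le y$, $P_{y,y}=1$, and $\deg P_{x,y}\le(\ell(y)-\ell(x)-1)/2$ for $x<y$. *)

theory Defs
  imports
    "HOL-Algebra.Generated_Groups"
    "HOL-Library.Extended_Nat"
    "HOL-Library.Poly_Mapping"
    "HOL-Computational_Algebra.Polynomial"
    "Graph_Theory.Digraph_Component"
    "Graph_Theory.Digraph_Isomorphism"
begin

section \<open>Coxeter systems\<close>

definition word_prod :: "('a, 'b) monoid_scheme \<Rightarrow> 'a list \<Rightarrow> 'a" where
  "word_prod W us = foldr (\<lambda>s x. s \<otimes>\<^bsub>W\<^esub> x) us \<one>\<^bsub>W\<^esub>"

definition coxeter_matrix :: "'a set \<Rightarrow> ('a \<Rightarrow> 'a \<Rightarrow> enat) \<Rightarrow> bool" where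
  "coxeter_matrix S m \<longleftrightarrow>
     (\<forall>s\<in>S. m s s = 1) \<and>
     (\<forall>s\<in>S. \<forall>t\<in>S. m s t = m t s \<and> (s \<noteq> t \<longrightarrow> 2 \<le> m s t))"

text \<open>Inserting a relator \<open>(s t)\<^sup>n\<close> with \<open>n = m s t < \<infinity>\<close> into a word over \<open>S\<close>.
  As \<open>m s s = 1\<close>, the words \<open>[s, s]\<close> are among the relators, so positive words suffice
  and the congruence generated by these insertions is the one defining the group
  \<open>\<langle>S | (s t)\<^bsup>m s t\<^esup> = 1 whenever m s t < \<infinity>\<rangle>\<close>.\<close>

inductive insert_relator :: "'a set \<Rightarrow> ('a \<Rightarrow> 'a \<Rightarrow> enat) \<Rightarrow> 'a list \<Rightarrow> 'a list \<Rightarrow> bool"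
  for S m where
  "us \<in> lists S \<Longrightarrow> vs \<in> lists S \<Longrightarrow> s \<in> S \<Longrightarrow> t \<in> S \<Longrightarrow> m s t = enat n \<Longrightarrow>
     insert_relator S m (us @ vs) (us @ concat (replicate n [s, t]) @ vs)"

definition coxeter_system :: "('a, 'b) monoid_scheme \<Rightarrow> 'a set \<Rightarrow> bool" where
  "coxeter_system W S \<longleftrightarrow>
     group W \<and> finite S \<and> S \<subseteq> carrier W \<and> generate W S = carrier W \<and>
     (\<exists>m. coxeter_matrix S m \<and>
        (\<forall>us\<in>lists S. \<forall>vs\<in>lists S.
           word_prod W us = word_prod W vs \<longleftrightarrow> equivclp (insert_relator S m) us vs))"

definition coxeter_subsystem ::
    "('a, 'b) monoid_scheme \<Rightarrow> 'a set \<Rightarrow> ('a, 'c) monoid_scheme \<Rightarrow> 'a set \<Rightarrow> bool" where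
  "coxeter_subsystem W S W' S' \<longleftrightarrow>
     S \<subseteq> S' \<and> carrier W = generate W' S \<and>
     (\<forall>x\<in>carrier W. \<forall>y\<in>carrier W. x \<otimes>\<^bsub>W\<^esub> y = x \<otimes>\<^bsub>W'\<^esub> y)"


section \<open>Length, reflections, Bruhat order and Bruhat graph\<close>

definition cox_length :: "('a, 'b) monoid_scheme \<Rightarrow> 'a set \<Rightarrow> 'a \<Rightarrow> nat" where
  "cox_length W S x = (LEAST n. \<exists>us\<in>lists S. length us = n \<and> word_prod W us = x)"

definition reduced_word :: "('a, 'b) monoid_scheme \<Rightarrow> 'a set \<Rightarrow> 'a \<Rightarrow> 'a list \<Rightarrow> bool" where
  "reduced_word W S x us \<longleftrightarrow>
     us \<in> lists S \<and> word_prod W us = x \<and> length us = cox_length W S x"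

definition reflections :: "('a, 'b) monoid_scheme \<Rightarrow> 'a set \<Rightarrow> 'a set" where
  "reflections W S = {x \<otimes>\<^bsub>W\<^esub> s \<otimes>\<^bsub>W\<^esub> inv\<^bsub>W\<^esub> x | x s. x \<in> carrier W \<and> s \<in> S}"

definition bruhat_edge :: "('a, 'b) monoid_scheme \<Rightarrow> 'a set \<Rightarrow> 'a \<Rightarrow> 'a \<Rightarrow> bool" where
  "bruhat_edge W S x z \<longleftrightarrow>
     x \<in> carrier W \<and>
     (\<exists>t\<in>reflections W S. z = x \<otimes>\<^bsub>W\<^esub> t \<and> cox_length W S x < cox_length W S z)"

definition bruhat_le :: "('a, 'b) monoid_scheme \<Rightarrow> 'a set \<Rightarrow> 'a \<Rightarrow> 'a \<Rightarrow> bool" where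
  "bruhat_le W S x y \<longleftrightarrow> x \<in> carrier W \<and> (bruhat_edge W S)\<^sup>*\<^sup>* x y"

definition bruhat_interval :: "('a, 'b) monoid_scheme \<Rightarrow> 'a set \<Rightarrow> 'a \<Rightarrow> 'a \<Rightarrow> 'a set" where
  "bruhat_interval W S x y = {z. bruhat_le W S x z \<and> bruhat_le W S z y}"

definition bruhat_graph :: "('a, 'b) monoid_scheme \<Rightarrow> 'a set \<Rightarrow> ('a, 'a \<times> 'a) pre_digraph" where
  "bruhat_graph W S =
     with_proj \<lparr>pverts = carrier W, parcs = {(x, z). bruhat_edge W S x z}\<rparr>"

definition bruhat_interval_graph ::
    "('a, 'b) monoid_scheme \<Rightarrow> 'a set \<Rightarrow> 'a \<Rightarrow> 'a \<Rightarrow> ('a, 'a \<times> 'a) pre_digraph" where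
  "bruhat_interval_graph W S x y = bruhat_graph W S \<restriction> bruhat_interval W S x y"


section \<open>Cubical lattices and cubulations\<close>

text \<open>Points of \<open>\<int>\<^sup>N\<close> are integer lists of length \<open>N\<close>; the list \<open>ks\<close> is
  \<open>(k\<^sub>1, \<dots>, k\<^sub>N)\<close>.\<close>

definition cube_vertices :: "nat list \<Rightarrow> int list set" where
  "cube_vertices ks =
     {u. length u = length ks \<and> (\<forall>i<length ks. 0 \<le> u ! i \<and> u ! i \<le> int (ks ! i))}"

definition cubical_lattice :: "nat list \<Rightarrow> (int list, int list \<times> int list) pre_digraph" where
  "cubical_lattice ks =
     with_proj \<lparr>pverts = cube_vertices ks,
       parcs = {(u, v). u \<in> cube_vertices ks \<and> v \<in> cube_vertices ks \<and>
                        (\<exists>i<length ks. v = u[i := u ! i + 1])}\<rparr>"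

definition can_be_cubulated :: "('v, 'e) pre_digraph \<Rightarrow> bool" where
  "can_be_cubulated D \<longleftrightarrow>
     (\<exists>ks H. ks \<noteq> [] \<and> spanning H D \<and> digraph_iso (cubical_lattice ks) H)"


section \<open>Hecke algebra and Kazhdan--Lusztig polynomials\<close>

text \<open>The ground ring is \<open>\<int>[q\<^bsup>1/2\<^esup>, q\<^bsup>-1/2\<^esup>]\<close>: a finitely supported function
  \<open>f :: int \<Rightarrow>\<^sub>0 int\<close> is the Laurent polynomial \<open>\<Sum>\<^sub>k f(k) q\<^bsup>k/2\<^esup>\<close>.\<close>

type_synonym laurent = "int \<Rightarrow>\<^sub>0 int"

definition q_half_power :: "int \<Rightarrow> laurent" where
  "q_half_power k = Poly_Mapping.single k 1"

abbreviation q_elem :: laurent where "q_elem \<equiv> q_half_power 2"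
abbreviation q_inv :: laurent where "q_inv \<equiv> q_half_power (- 2)"

definition laurent_bar :: "laurent \<Rightarrow> laurent" where
  "laurent_bar f = Poly_Mapping.map_key uminus f"

definition poly_in_q :: "int poly \<Rightarrow> laurent" where
  "poly_in_q p = poly (map_poly of_int p) q_elem"

text \<open>The Hecke algebra is the free module with basis \<open>T\<^sub>w\<close>, \<open>w \<in> W\<close>,
  \<open>T\<^sub>w\<close> being \<open>hecke_T w\<close>.\<close>

type_synonym 'a hecke = "'a \<Rightarrow>\<^sub>0 laurent"

definition hecke_T :: "'a \<Rightarrow> 'a hecke" where
  "hecke_T w = Poly_Mapping.single w 1"

definition hecke_scale :: "laurent \<Rightarrow> 'a hecke \<Rightarrow> 'a hecke" where
  "hecke_scale c h = Poly_Mapping.map ((*) c) h"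

definition hecke_T_mult_gen ::
    "('a, 'b) monoid_scheme \<Rightarrow> 'a set \<Rightarrow> 'a \<Rightarrow> 'a \<Rightarrow> 'a hecke" where
  "hecke_T_mult_gen W S w s =
     (if cox_length W S w < cox_length W S (w \<otimes>\<^bsub>W\<^esub> s)
      then hecke_T (w \<otimes>\<^bsub>W\<^esub> s)
      else hecke_scale q_elem (hecke_T (w \<otimes>\<^bsub>W\<^esub> s)) + hecke_scale (q_elem - 1) (hecke_T w))"

definition hecke_mult_gen ::
    "('a, 'b) monoid_scheme \<Rightarrow> 'a set \<Rightarrow> 'a hecke \<Rightarrow> 'a \<Rightarrow> 'a hecke" where
  "hecke_mult_gen W S h s =
     (\<Sum>w\<in>Poly_Mapping.keys h.
        hecke_scale (Poly_Mapping.lookup h w) (hecke_T_mult_gen W S w s))"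

text \<open>Right multiplication by \<open>T\<^sub>s\<^bsup>-1\<^esup> = q\<^bsup>-1\<^esup> T\<^sub>s - (1 - q\<^bsup>-1\<^esup>)\<close>.\<close>

definition hecke_mult_gen_inv ::
    "('a, 'b) monoid_scheme \<Rightarrow> 'a set \<Rightarrow> 'a hecke \<Rightarrow> 'a \<Rightarrow> 'a hecke" where
  "hecke_mult_gen_inv W S h s =
     hecke_scale q_inv (hecke_mult_gen W S h s) - hecke_scale (1 - q_inv) h"

text \<open>The bar involution sends \<open>T\<^sub>w\<close> to the inverse of \<open>T\<^sub>v\<close>, where \<open>v\<close> is the
  inverse of \<open>w\<close>. For a reduced word \<open>w = s\<^sub>1 \<dots> s\<^sub>k\<close> one has
  \<open>T\<^sub>v = T\<^bsub>s\<^sub>k\<^esub> \<dots> T\<^bsub>s\<^sub>1\<^esub>\<close>, so the image of \<open>T\<^sub>w\<close> is the product of the inverses of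
  \<open>T\<^bsub>s\<^sub>1\<^esub>, \<dots>, T\<^bsub>s\<^sub>k\<^esub>\<close> in this order, for any choice of the reduced word.\<close>

definition hecke_bar_T :: "('a, 'b) monoid_scheme \<Rightarrow> 'a set \<Rightarrow> 'a \<Rightarrow> 'a hecke" where
  "hecke_bar_T W S w =
     foldl (hecke_mult_gen_inv W S) (hecke_T \<one>\<^bsub>W\<^esub>) (SOME us. reduced_word W S w us)"

definition hecke_bar :: "('a, 'b) monoid_scheme \<Rightarrow> 'a set \<Rightarrow> 'a hecke \<Rightarrow> 'a hecke" where
  "hecke_bar W S h =
     (\<Sum>w\<in>Poly_Mapping.keys h.
        hecke_scale (laurent_bar (Poly_Mapping.lookup h w)) (hecke_bar_T W S w))"

text \<open>\<open>q\<^bsup>-l(y)/2\<^esup> \<Sum>\<^bsub>x \<le> y\<^esub> P\<^sub>x(q) T\<^sub>x\<close>, which is the Kazhdan--Lusztig basis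
  element (usually written \<open>C'\<^sub>y\<close>) when \<open>P\<^sub>x = P\<^bsub>x,y\<^esub>\<close>.\<close>

definition kl_element ::
    "('a, 'b) monoid_scheme \<Rightarrow> 'a set \<Rightarrow> 'a \<Rightarrow> ('a \<Rightarrow> int poly) \<Rightarrow> 'a hecke" where
  "kl_element W S y P =
     hecke_scale (q_half_power (- int (cox_length W S y)))
       (\<Sum>x\<in>{x. bruhat_le W S x y}. hecke_scale (poly_in_q (P x)) (hecke_T x))"

definition kl_family :: "('a, 'b) monoid_scheme \<Rightarrow> 'a set \<Rightarrow> 'a \<Rightarrow> ('a \<Rightarrow> int poly) \<Rightarrow> bool" where
  "kl_family W S y P \<longleftrightarrow>
     (\<forall>x. \<not> bruhat_le W S x y \<longrightarrow> P x = 0) \<and>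
     P y = 1 \<and>
     (\<forall>x. bruhat_le W S x y \<and> x \<noteq> y \<longrightarrow>
        2 * degree (P x) + 1 + cox_length W S x \<le> cox_length W S y) \<and>
     hecke_bar W S (kl_element W S y P) = kl_element W S y P"

text \<open>For every \<open>y \<in> W\<close> there is exactly one such family, by the theorem of Kazhdan and
  Lusztig.\<close>

definition kl_poly :: "('a, 'b) monoid_scheme \<Rightarrow> 'a set \<Rightarrow> 'a \<Rightarrow> 'a \<Rightarrow> int poly" where
  "kl_poly W S x y = (THE P. kl_family W S y P) x"

end

(* The parity of the number of occurrences of a reflection t among the elements
   u_i^{-1} s_i u_i, u_i = s_{i+1} ... s_k, of a word s_1 ... s_k depends only on the product of the
   word; this gives the strong exchange condition for W'. Exchange shows that below an element of
   the parabolic subgroup W every Bruhat edge of W' is a Bruhat edge of W, and that reduced words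
   of elements of W use only letters of S. Hence the interval [1,y] has the same Bruhat graph in
   both groups. The bar involution is computed from reduced words and right multiplications that
   stay inside W, so the conditions characterising the Kazhdan-Lusztig polynomials P_{x,y} are
   literally the same for W and W'; neither their existence nor their uniqueness is needed. *)

theory Submission
  imports Defs
begin

section \<open>The strong exchange condition\<close>

declare in_lists_conv_set [simp]

section \<open>Words in a group and the conjugates of their letters\<close>

lemma alternating_lists:
  "s \<in> A \<Longrightarrow> t \<in> A \<Longrightarrow> concat (replicate n [s, t]) \<in> lists A"
  by (induction n) auto

lemma word_prod_simps [simp]:
  "word_prod G [] = \<one>\<^bsub>G\<^esub>" "word_prod G (s # us) = s \<otimes>\<^bsub>G\<^esub> word_prod G us"
  by (simp_all add: word_prod_def)

lemma (in group) word_prod_closed [simp]: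
  "us \<in> lists (carrier G) \<Longrightarrow> word_prod G us \<in> carrier G"
  by (induction us) auto

lemma (in group) word_prod_append [simp]:
  "us \<in> lists (carrier G) \<Longrightarrow> vs \<in> lists (carrier G) \<Longrightarrow>
     word_prod G (us @ vs) = word_prod G us \<otimes> word_prod G vs"
  by (induction us) (auto simp: m_assoc)

lemma (in group) word_prod_replicate:
  "s \<in> carrier G \<Longrightarrow> t \<in> carrier G \<Longrightarrow>
     word_prod G (concat (replicate n [s, t])) = (s \<otimes> t) [^] n"
proof (induction n)
  case (Suc n)
  then show ?case
    using nat_pow_mult[of "s \<otimes> t" 1 n] by (simp add: m_assoc)
qed simp

text \<open>Right multiplication of the product by an entry deletes the corresponding letter. A list
  keeps multiplicities, whose parities turn out to depend only on the product of the word.\<close>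

primrec right_refls :: "('a, 'b) monoid_scheme \<Rightarrow> 'a list \<Rightarrow> 'a list" where
  "right_refls G [] = []"
| "right_refls G (s # us) =
     (inv\<^bsub>G\<^esub> (word_prod G us) \<otimes>\<^bsub>G\<^esub> s \<otimes>\<^bsub>G\<^esub> word_prod G us) # right_refls G us"

lemma (in group) mult_inv_cancel [simp]:
  "x \<in> carrier G \<Longrightarrow> y \<in> carrier G \<Longrightarrow> x \<otimes> (inv x \<otimes> y) = y"
  "x \<in> carrier G \<Longrightarrow> y \<in> carrier G \<Longrightarrow> inv x \<otimes> (x \<otimes> y) = y"
  by (simp_all flip: m_assoc)

lemma (in group) conj_eq_iff:
  assumes "v \<in> carrier G" "a \<in> carrier G" "t \<in> carrier G"
  shows "inv v \<otimes> a \<otimes> v = t \<longleftrightarrow> a = v \<otimes> t \<otimes> inv v"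
proof
  assume "inv v \<otimes> a \<otimes> v = t"
  then have "v \<otimes> t \<otimes> inv v = v \<otimes> (inv v \<otimes> a \<otimes> v) \<otimes> inv v" by simp
  also have "\<dots> = (v \<otimes> inv v) \<otimes> a \<otimes> (v \<otimes> inv v)"
    using assms by (simp only: m_assoc m_closed inv_closed)
  finally show "a = v \<otimes> t \<otimes> inv v" using assms by simp
next
  assume "a = v \<otimes> t \<otimes> inv v"
  then have "inv v \<otimes> a \<otimes> v = (inv v \<otimes> v) \<otimes> t \<otimes> (inv v \<otimes> v)"
    using assms by (simp only: m_assoc m_closed inv_closed)
  then show "inv v \<otimes> a \<otimes> v = t" using assms by simp
qed

text \<open>A suffix with product v turns each entry a of the prefix into v^-1 a v, so t arises
  exactly where the prefix alone has v t v^-1.\<close>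

lemma (in group) count_right_refls_append:
  assumes "us \<in> lists (carrier G)" "vs \<in> lists (carrier G)" "t \<in> carrier G"
  shows "count_list (right_refls G (us @ vs)) t =
     count_list (right_refls G us) (word_prod G vs \<otimes> t \<otimes> inv (word_prod G vs)) +
     count_list (right_refls G vs) t"
  using assms(1)
proof (induction us)
  case (Cons s us)
  define u v where "u = word_prod G us" and "v = word_prod G vs"
  have c: "s \<in> carrier G" "u \<in> carrier G" "v \<in> carrier G"
    using Cons assms by (auto simp: u_def v_def)
  have "inv (u \<otimes> v) \<otimes> s \<otimes> (u \<otimes> v) = inv v \<otimes> (inv u \<otimes> s \<otimes> u) \<otimes> v"
    using c by (simp add: inv_mult_group m_assoc)
  then have "inv (u \<otimes> v) \<otimes> s \<otimes> (u \<otimes> v) = t \<longleftrightarrow> inv u \<otimes> s \<otimes> u = v \<otimes> t \<otimes> inv v"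
    using conj_eq_iff[of v "inv u \<otimes> s \<otimes> u" t] c assms by simp
  then show ?case
    using Cons assms by (simp add: u_def v_def)
qed simp

section \<open>Generators, relators and words of a Coxeter group\<close>

locale coxeter = fixes W :: "('a, 'b) monoid_scheme" (structure) and S :: "'a set"
  assumes coxeter: "coxeter_system W S"
begin

sublocale group W
  using coxeter by (simp add: coxeter_system_def)

lemma gens: "S \<subseteq> carrier W" "generate W S = carrier W"
  using coxeter by (simp_all add: coxeter_system_def)

lemma gen_closed [simp]: "s \<in> S \<Longrightarrow> s \<in> carrier W"
  using gens by auto

lemma lists_carrier [simp]: "us \<in> lists S \<Longrightarrow> us \<in> lists (carrier W)"
  using gens by auto

text \<open>\<open>coxeter_system\<close> only asserts that a matrix exists; one is fixed here so
  that its relators can be named.\<close>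

definition "cox_matrix = (SOME m. coxeter_matrix S m \<and>
        (\<forall>us\<in>lists S. \<forall>vs\<in>lists S.
           word_prod W us = word_prod W vs \<longleftrightarrow> equivclp (insert_relator S m) us vs))"

lemma cox_matrix:
  "coxeter_matrix S cox_matrix"
  "us \<in> lists S \<Longrightarrow> vs \<in> lists S \<Longrightarrow>
     word_prod W us = word_prod W vs \<longleftrightarrow> equivclp (insert_relator S cox_matrix) us vs"
proof -
  have "\<exists>m. coxeter_matrix S m \<and>
        (\<forall>us\<in>lists S. \<forall>vs\<in>lists S.
           word_prod W us = word_prod W vs \<longleftrightarrow> equivclp (insert_relator S m) us vs)"
    using coxeter by (simp add: coxeter_system_def)
  from someI_ex[OF this, folded cox_matrix_def]
  show "coxeter_matrix S cox_matrix"
    "us \<in> lists S \<Longrightarrow> vs \<in> lists S \<Longrightarrow>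
     word_prod W us = word_prod W vs \<longleftrightarrow> equivclp (insert_relator S cox_matrix) us vs"
    by auto
qed

lemma relator:
  assumes "s \<in> S" "t \<in> S" "cox_matrix s t = enat n"
  shows "(s \<otimes> t) [^] n = \<one>"
proof -
  let ?r = "concat (replicate n [s, t])"
  have r: "?r \<in> lists S" using assms by (intro alternating_lists)
  have "insert_relator S cox_matrix [] ?r"
    using insert_relator.intros[of "[]" S "[]" s t cox_matrix n] assms by simp
  then have "word_prod W [] = word_prod W ?r"
    using cox_matrix(2)[OF _ r, of "[]"] by (simp add: r_into_equivclp)
  then show ?thesis using assms by (simp add: word_prod_replicate)
qed

lemma gen_square [simp]: "s \<in> S \<Longrightarrow> s \<otimes> s = \<one>"
  using relator[of s s 1] cox_matrix(1) by (simp add: coxeter_matrix_def one_enat_def)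

lemma gen_cancel [simp]: "s \<in> S \<Longrightarrow> x \<in> carrier W \<Longrightarrow> s \<otimes> (s \<otimes> x) = x"
  by (simp flip: m_assoc)

lemma gen_inv [simp]: "s \<in> S \<Longrightarrow> inv s = s"
  by (simp add: inv_equality)

lemma word_prod_rev: "us \<in> lists S \<Longrightarrow> word_prod W (rev us) = inv (word_prod W us)"
  by (induction us) (auto simp: inv_mult_group)

lemma carrier_word:
  assumes "x \<in> carrier W"
  obtains us where "us \<in> lists S" "word_prod W us = x"
proof -
  have "x \<in> generate W S" using assms gens by simp
  then have "\<exists>us\<in>lists S. word_prod W us = x"
  proof (induction rule: generate.induct)
    case one
    show ?case by (rule bexI[of _ "[]"]) auto
  next
    case (incl h)
    then show ?case by (intro bexI[of _ "[h]"]) auto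
  next
    case (inv h)
    then show ?case by (intro bexI[of _ "[h]"]) auto
  next
    case (eng h1 h2)
    then obtain us vs where "us \<in> lists S" "vs \<in> lists S" "word_prod W us = h1" "word_prod W vs = h2"
      by blast
    then show ?case by (intro bexI[of _ "us @ vs"]) auto
  qed
  then show ?thesis using that by blast
qed

text \<open>In the reversed list the entries are \<open>(ts)\<^sup>i t\<close> for \<open>i < 2n\<close>, so \<open>(ts)\<^sup>n = \<one>\<close> makes each
  of them occur an even number of times.\<close>

lemma right_refls_relator:
  assumes "s \<in> S" "t \<in> S"
  shows "right_refls W (concat (replicate n [s, t])) =
    rev (map (\<lambda>i. (t \<otimes> s) [^] i \<otimes> t) [0..<2 * n])"
proof (induction n)
  case (Suc n)
  define b g where "b = (t \<otimes> s) [^] n" and "g = (s \<otimes> t) [^] n"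
  have c: "s \<in> carrier W" "t \<in> carrier W" "b \<in> carrier W" "g \<in> carrier W"
    using assms by (auto simp: b_def g_def)
  have inv_g: "inv g = b"
    using nat_pow_inv[of "s \<otimes> t" n] assms by (simp add: g_def b_def inv_mult_group)
  have tg: "t \<otimes> g = b \<otimes> t"
    unfolding g_def b_def
  proof (induction n)
    case (Suc n)
    have "t \<otimes> (s \<otimes> t) [^] Suc n = (t \<otimes> (s \<otimes> t) [^] n) \<otimes> (s \<otimes> t)"
      using assms by (simp add: m_assoc)
    also have "\<dots> = ((t \<otimes> s) [^] n \<otimes> t) \<otimes> (s \<otimes> t)"
      by (simp only: Suc)
    also have "\<dots> = (t \<otimes> s) [^] n \<otimes> (t \<otimes> s) \<otimes> t"
      using assms by (simp add: m_assoc)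
    finally show ?case by simp
  qed (use assms in simp)
  have bb: "(t \<otimes> s) [^] (2 * n) = b \<otimes> b"
    using assms by (simp add: b_def nat_pow_mult mult_2)
  have bs: "b \<otimes> (t \<otimes> s) = (t \<otimes> s) \<otimes> b"
    using nat_pow_Suc2[of "t \<otimes> s" n] assms by (simp add: b_def)
  \<comment> \<open>The letters t and s put in front contribute the next two terms of the sequence,
    with exponents 2n and 2n + 1.\<close>
  have 1: "inv g \<otimes> t \<otimes> g = (t \<otimes> s) [^] (2 * n) \<otimes> t"
    using c by (simp add: inv_g bb m_assoc tg)
  have "inv (t \<otimes> g) \<otimes> s \<otimes> (t \<otimes> g) = b \<otimes> t \<otimes> s \<otimes> (b \<otimes> t)"
    using c assms by (simp add: inv_mult_group inv_g flip: tg)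
  also have "\<dots> = b \<otimes> ((t \<otimes> s) \<otimes> b) \<otimes> t"
    using c by (simp add: m_assoc)
  also have "\<dots> = b \<otimes> (b \<otimes> (t \<otimes> s)) \<otimes> t"
    by (simp only: bs)
  also have "\<dots> = (t \<otimes> s) [^] Suc (2 * n) \<otimes> t"
    using c by (simp add: bb m_assoc)
  finally have 2: "inv (t \<otimes> g) \<otimes> s \<otimes> (t \<otimes> g) = (t \<otimes> s) [^] Suc (2 * n) \<otimes> t" .
  let ?f = "\<lambda>i. (t \<otimes> s) [^] i \<otimes> t"
  have "right_refls W (concat (replicate (Suc n) [s, t])) = (inv (t \<otimes> g) \<otimes> s \<otimes> (t \<otimes> g)) #
      (inv g \<otimes> t \<otimes> g) # right_refls W (concat (replicate n [s, t]))"
    using c by (simp add: g_def word_prod_replicate)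
  also have "\<dots> = ?f (Suc (2 * n)) # ?f (2 * n) # rev (map ?f [0..<2 * n])"
    by (simp only: 1 2 Suc)
  also have "\<dots> = rev (map ?f [0..<2 * Suc n])"
    by simp
  finally show ?case .
qed simp

section \<open>Parity of multiplicities\<close>

lemma even_count_relator:
  assumes "s \<in> S" "t \<in> S" "cox_matrix s t = enat n"
  shows "even (count_list (right_refls W (concat (replicate n [s, t]))) a)"
proof -
  have "(s \<otimes> t) [^] n = \<one>" by (rule relator[OF assms])
  then have ts: "(t \<otimes> s) [^] n = \<one>"
    using nat_pow_inv[of "s \<otimes> t" n] assms by (simp add: inv_mult_group)
  let ?f = "\<lambda>i. (t \<otimes> s) [^] i \<otimes> t"
  have per: "?f (i + n) = ?f i" for i
    using nat_pow_mult[of "t \<otimes> s" i n] ts assms by simp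
  \<comment> \<open>The sequence has period n, so its 2n terms are one block taken twice and every
    count is doubled.\<close>
  have "[0..<2 * n] = [0..<n] @ map (\<lambda>i. i + n) [0..<n]"
    using upt_add_eq_append[of 0 n n] by (simp add: map_add_upt mult_2)
  then have "map ?f [0..<2 * n] = map ?f [0..<n] @ map ?f [0..<n]"
    by (simp add: per o_def del: upt_Suc)
  then show ?thesis
    using assms by (simp add: right_refls_relator)
qed

text \<open>A relator has product one, so the prefix is tested against the same conjugate of
  \<open>a\<close> with or without it, and the entries of the relator itself add an even
  number.\<close>

lemma insert_relator_parity:
  assumes "insert_relator S cox_matrix us vs" "a \<in> carrier W"
  shows "even (count_list (right_refls W us) a) = even (count_list (right_refls W vs) a)"
  using assms(1)
proof cases
  case (1 us' vs' s t n)
  let ?r = "concat (replicate n [s, t])"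
  let ?v = "word_prod W vs'"
  let ?b = "?v \<otimes> a \<otimes> inv ?v"
  have r: "?r \<in> lists (carrier W)" "word_prod W ?r = \<one>"
    using 1 alternating_lists[of s "carrier W" t n] by (auto simp: word_prod_replicate relator)
  have l: "us' \<in> lists (carrier W)" "vs' \<in> lists (carrier W)" "?v \<in> carrier W"
    using 1 by auto
  have "count_list (right_refls W vs) a = count_list (right_refls W us') ?b +
      (count_list (right_refls W ?r) ?b + count_list (right_refls W vs') a)"
    using l r assms 1(2) count_right_refls_append[of us' "?r @ vs'" a]
      count_right_refls_append[of ?r vs' a] by simp
  moreover have "count_list (right_refls W us) a =
      count_list (right_refls W us') ?b + count_list (right_refls W vs') a"
    using l assms 1(1) count_right_refls_append[of us' vs' a] by simp
  moreover have "even (count_list (right_refls W ?r) ?b)"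
    using 1 by (intro even_count_relator)
  ultimately show ?thesis by simp
qed

text \<open>The presentation connects words of equal product by insertions and deletions of
  relators, each of which preserves the parity.\<close>

lemma word_prod_parity:
  assumes "us \<in> lists S" "vs \<in> lists S" "word_prod W us = word_prod W vs" "a \<in> carrier W"
  shows "even (count_list (right_refls W us) a) = even (count_list (right_refls W vs) a)"
proof -
  have "equivclp (insert_relator S cox_matrix) us vs"
    using cox_matrix(2)[OF assms(1,2)] assms(3) by blast
  then show ?thesis
  proof (induction rule: equivclp_induct)
    case (step us' vs')
    then show ?case using insert_relator_parity assms(4) by blast
  qed simp
qed

lemma reflection_closed [simp]: "t \<in> reflections W S \<Longrightarrow> t \<in> carrier W"
  by (auto simp: reflections_def)

lemma reflection_square:
  assumes "t \<in> reflections W S"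
  shows "t \<otimes> t = \<one>"
proof -
  obtain x s where t: "x \<in> carrier W" "s \<in> S" "t = x \<otimes> s \<otimes> inv x"
    using assms unfolding reflections_def by blast
  have "inv t = t"
    using t(1,2) unfolding t(3) by (simp add: inv_mult_group m_assoc)
  then show ?thesis
    using r_inv[OF reflection_closed[OF assms]] by simp
qed

text \<open>For t = x s x^-1, the middle letter gives the palindrome
  \<open>xs @ [s] @ rev xs\<close> one occurrence of t more than \<open>xs @ rev xs\<close>, whose
  product is one and whose count is therefore even.\<close>

lemma odd_count_reflection:
  assumes "t \<in> reflections W S"
  obtains ts where "ts \<in> lists S" "word_prod W ts = t" "odd (count_list (right_refls W ts) t)"
proof -
  obtain x s where t: "x \<in> carrier W" "s \<in> S" "t = x \<otimes> s \<otimes> inv x"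
    using assms unfolding reflections_def by blast
  obtain xs where xs: "xs \<in> lists S" "word_prod W xs = x"
    using t carrier_word by blast
  have tc: "t \<in> carrier W" using assms by simp
  let ?N = "\<lambda>us. count_list (right_refls W us)"
  have rx: "rev xs \<in> lists S" "word_prod W (rev xs) = inv x"
    using xs by (auto simp: word_prod_rev)
  have conj: "inv x \<otimes> t \<otimes> x = s"
    using conj_eq_iff[OF t(1) tc gen_closed[OF t(2)]] t(3) by blast
  have 1: "?N (xs @ rev xs) t = ?N xs s + ?N (rev xs) t"
    using count_right_refls_append[of xs "rev xs" t] xs rx t(1,2) tc conj by simp
  have 2: "?N (xs @ [s] @ rev xs) t = ?N xs s + 1 + ?N (rev xs) t"
    using count_right_refls_append[of "xs @ [s]" "rev xs" t]
      count_right_refls_append[of xs "[s]" s] xs rx t(1,2) tc conj by (simp add: m_assoc)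
  have "even (?N (xs @ rev xs) t) = even (?N [] t)"
    using xs rx t(1) tc by (intro word_prod_parity) auto
  with 1 2 have "odd (?N (xs @ [s] @ rev xs) t)" by simp
  moreover have "word_prod W (xs @ [s] @ rev xs) = t"
    using xs rx t by (simp add: m_assoc)
  ultimately show ?thesis using that[of "xs @ [s] @ rev xs"] xs t(2) by auto
qed

text \<open>If u is the product of the letters after s, then s u (u^-1 s u) = u, so s disappears.
  The inclusion of letter sets keeps the shorter word over the same generators.\<close>

lemma right_refls_delete:
  assumes "us \<in> lists S" "a \<in> set (right_refls W us)"
  obtains ws where "set ws \<subseteq> set us" "length us = Suc (length ws)"
    "word_prod W ws = word_prod W us \<otimes> a" "a \<in> reflections W S"
proof -
  have "\<exists>ws. set ws \<subseteq> set us \<and> length us = Suc (length ws) \<and>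
      word_prod W ws = word_prod W us \<otimes> a \<and> a \<in> reflections W S"
    using assms
  proof (induction us)
    case (Cons s us)
    let ?u = "word_prod W us"
    have c: "s \<in> S" "?u \<in> carrier W" using Cons by auto
    show ?case
    proof (cases "a \<in> set (right_refls W us)")
      case True
      then obtain ws where ws: "set ws \<subseteq> set us" "length us = Suc (length ws)"
        "word_prod W ws = ?u \<otimes> a" "a \<in> reflections W S"
        using Cons by auto
      then show ?thesis
        using c by (intro exI[of _ "s # ws"]) (auto simp: m_assoc)
    next
      case False
      then have a: "a = inv ?u \<otimes> s \<otimes> ?u" using Cons by simp
      have "s \<otimes> ?u \<otimes> a = ?u"
        unfolding a using c by (simp add: m_assoc)
      moreover have "a \<in> reflections W S"
        unfolding reflections_def a using c
        by (intro CollectI exI[of _ "inv ?u"] exI[of _ s]) simp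
      ultimately show ?thesis by (intro exI[of _ us]) auto
    qed
  qed simp
  then show ?thesis using that by blast
qed

text \<open>Multiplication by \<open>t\<close> flips the parity of the multiplicity of \<open>t\<close>, so \<open>t\<close> occurs in
  every word of \<open>z\<close> or in every word of \<open>z t\<close>.\<close>

lemma reflection_dichotomy:
  assumes "t \<in> reflections W S" "zs \<in> lists S" "us \<in> lists S"
    "word_prod W us = word_prod W zs \<otimes> t"
  shows "t \<in> set (right_refls W zs) \<or> t \<in> set (right_refls W us)"
proof (rule ccontr)
  assume not: "\<not> ?thesis"
  obtain ts where ts: "ts \<in> lists S" "word_prod W ts = t" "odd (count_list (right_refls W ts) t)"
    using odd_count_reflection assms by blast
  have "t \<otimes> t \<otimes> inv t = t"
    using assms by (simp add: m_assoc)
  then have "count_list (right_refls W (zs @ ts)) t =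
      count_list (right_refls W zs) t + count_list (right_refls W ts) t"
    using count_right_refls_append[of zs ts t] ts assms by simp
  moreover have "even (count_list (right_refls W (zs @ ts)) t) = even (count_list (right_refls W us) t)"
    using assms ts by (intro word_prod_parity) auto
  ultimately show False
    using not ts by (auto simp: count_list_0_iff)
qed

section \<open>Length and strong exchange\<close>

lemma cox_length_le: "us \<in> lists S \<Longrightarrow> cox_length W S (word_prod W us) \<le> length us"
  unfolding cox_length_def by (rule Least_le) auto

lemma reduced_word_ex:
  assumes "x \<in> carrier W"
  obtains us where "reduced_word W S x us"
proof -
  obtain us where "us \<in> lists S" "word_prod W us = x" using assms carrier_word by blast
  then have "\<exists>n. \<exists>us\<in>lists S. length us = n \<and> word_prod W us = x" by blast
  from LeastI_ex[OF this] show ?thesis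
    using that by (auto simp: reduced_word_def cox_length_def)
qed

text \<open>Let z be the product of \<open>zs\<close>. Otherwise t is an entry for a reduced word of
  z t, and deleting the letter there leaves a word for z shorter than the length of z t. Admitting
  equal lengths makes the contrapositive a strict increase.\<close>

lemma strong_exchange:
  assumes "t \<in> reflections W S" "zs \<in> lists S"
    "cox_length W S (word_prod W zs \<otimes> t) \<le> cox_length W S (word_prod W zs)"
  shows "t \<in> set (right_refls W zs)"
proof (rule ccontr)
  assume not: "\<not> ?thesis"
  let ?z = "word_prod W zs"
  have c: "?z \<in> carrier W" "t \<in> carrier W" using assms by auto
  then obtain us where us: "reduced_word W S (?z \<otimes> t) us"
    using reduced_word_ex[of "?z \<otimes> t"] by auto
  then have S: "us \<in> lists S" by (simp add: reduced_word_def)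
  have "t \<in> set (right_refls W us)"
    using us reflection_dichotomy[of t zs us] assms not by (auto simp: reduced_word_def)
  from right_refls_delete[OF S this] obtain ws where ws: "set ws \<subseteq> set us" "length us = Suc (length ws)"
    "word_prod W ws = word_prod W us \<otimes> t"
    by blast
  have "word_prod W ws = ?z"
    using ws us c assms by (simp add: reduced_word_def m_assoc reflection_square)
  moreover have "ws \<in> lists S" using ws us by (auto simp: reduced_word_def)
  ultimately have "cox_length W S ?z \<le> length ws" using cox_length_le[of ws] by simp
  then show False using us ws assms by (simp add: reduced_word_def)
qed

lemma gen_reflection: "s \<in> S \<Longrightarrow> s \<in> reflections W S"
  unfolding reflections_def by (intro CollectI exI[of _ \<one>] exI[of _ s]) simp

lemma cox_length_gen: "s \<in> S \<Longrightarrow> cox_length W S s = 1"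
proof -
  assume s: "s \<in> S"
  \<comment> \<open>The empty word has no entries, so exchange forces the length to rise from the
    unit to s.\<close>
  then have "\<not> cox_length W S s \<le> cox_length W S \<one>"
    using strong_exchange[of s "[]"] gen_reflection by auto
  moreover have "cox_length W S s \<le> 1" using cox_length_le[of "[s]"] s by simp
  ultimately show ?thesis by simp
qed

lemma edge_closed: "bruhat_edge W S x z \<Longrightarrow> x \<in> carrier W \<and> z \<in> carrier W"
  by (auto simp: bruhat_edge_def)

end


section \<open>Standard parabolic subgroups\<close>

text \<open>Both groups share one element type, so elements and words of \<open>W\<close> are read
  in \<open>W'\<close> without an embedding.\<close>

locale coxeter_pair =
  sub: coxeter W S + sup: coxeter W' S'
  for W :: "('a, 'b) monoid_scheme" and S :: "'a set"
    and W' :: "('a, 'c) monoid_scheme" and S' :: "'a set" +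
  assumes subsystem: "coxeter_subsystem W S W' S'"
begin

lemma gens_sub: "S \<subseteq> S'"
  using subsystem by (simp add: coxeter_subsystem_def)

lemma carrier_sub: "x \<in> carrier W \<Longrightarrow> x \<in> carrier W'"
proof -
  have "S \<subseteq> carrier W'" using gens_sub sup.gens by auto
  then show "x \<in> carrier W \<Longrightarrow> x \<in> carrier W'"
    using subsystem sup.generate_in_carrier[of S] by (auto simp: coxeter_subsystem_def)
qed

lemma mult_eq: "x \<in> carrier W \<Longrightarrow> y \<in> carrier W \<Longrightarrow> x \<otimes>\<^bsub>W'\<^esub> y = x \<otimes>\<^bsub>W\<^esub> y"
  using subsystem by (simp add: coxeter_subsystem_def)

text \<open>The subsystem relation speaks of generators, carrier and products only. The unit of
  \<open>W\<close> is idempotent in \<open>W'\<close>, hence the unit there.\<close>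

lemma one_eq: "\<one>\<^bsub>W'\<^esub> = \<one>\<^bsub>W\<^esub>"
proof -
  have "\<one>\<^bsub>W\<^esub> \<otimes>\<^bsub>W'\<^esub> \<one>\<^bsub>W\<^esub> = \<one>\<^bsub>W\<^esub>" by (simp add: mult_eq)
  then show ?thesis
    using carrier_sub[OF sub.one_closed] sup.l_cancel_one[of "\<one>\<^bsub>W\<^esub>" "\<one>\<^bsub>W\<^esub>"] by simp
qed

lemma inv_eq: "x \<in> carrier W \<Longrightarrow> inv\<^bsub>W'\<^esub> x = inv\<^bsub>W\<^esub> x"
  by (rule sup.inv_equality) (simp_all add: mult_eq one_eq carrier_sub)

lemma lists_sub: "us \<in> lists S \<Longrightarrow> us \<in> lists S'"
  using gens_sub by auto

lemma word_prod_eq: "us \<in> lists S \<Longrightarrow> word_prod W' us = word_prod W us"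
  by (induction us) (auto simp: mult_eq one_eq)

lemma reflections_sub: "t \<in> reflections W S \<Longrightarrow> t \<in> reflections W' S'"
proof -
  assume "t \<in> reflections W S"
  then obtain x s where t: "x \<in> carrier W" "s \<in> S" "t = x \<otimes>\<^bsub>W\<^esub> s \<otimes>\<^bsub>W\<^esub> inv\<^bsub>W\<^esub> x"
    unfolding reflections_def by blast
  then have "t = x \<otimes>\<^bsub>W'\<^esub> s \<otimes>\<^bsub>W'\<^esub> inv\<^bsub>W'\<^esub> x"
    by (simp add: inv_eq mult_eq)
  then show ?thesis using t(1,2) carrier_sub gens_sub unfolding reflections_def by blast
qed

lemma right_refls_eq: "us \<in> lists S \<Longrightarrow> right_refls W' us = right_refls W us"
  by (induction us) (auto simp: mult_eq inv_eq word_prod_eq)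

text \<open>If the length of \<open>W'\<close> did not increase along an \<open>S\<close>-reduced word, the exchange condition
  in \<open>W'\<close> would delete a letter of it and leave a shorter word over \<open>S\<close>.\<close>

lemma reduced_length:
  assumes "us \<in> lists S" "length us = cox_length W S (word_prod W us)"
  shows "cox_length W' S' (word_prod W us) = length us"
  using assms
proof (induction us rule: rev_induct)
  case Nil
  then show ?case using sup.cox_length_le[of "[]"] by (simp add: one_eq)
next
  case (snoc s vs)
  let ?v = "word_prod W vs"
  have l: "vs \<in> lists S" "s \<in> S" "?v \<in> carrier W" using snoc.prems by auto
  have vs: "word_prod W (vs @ [s]) = ?v \<otimes>\<^bsub>W\<^esub> s" using l by simp
  \<comment> \<open>Appending s to a reduced word of the prefix product gives another word for the
    whole product; comparing lengths shows that the prefix \<open>vs\<close> is reduced.\<close>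
  obtain ws where ws: "reduced_word W S ?v ws" using sub.reduced_word_ex l by blast
  have "word_prod W (ws @ [s]) = ?v \<otimes>\<^bsub>W\<^esub> s" "ws @ [s] \<in> lists S"
    using ws l by (auto simp: reduced_word_def)
  with vs have "length (vs @ [s]) \<le> length (ws @ [s])"
    using sub.cox_length_le[of "ws @ [s]"] snoc.prems by simp
  moreover have "length ws \<le> length vs"
    using ws sub.cox_length_le[of vs] l by (simp add: reduced_word_def)
  ultimately have len: "cox_length W' S' ?v = length vs"
    using snoc.IH l ws by (simp add: reduced_word_def)
  have "\<not> cox_length W' S' (?v \<otimes>\<^bsub>W\<^esub> s) \<le> cox_length W' S' ?v"
  proof
    assume "cox_length W' S' (?v \<otimes>\<^bsub>W\<^esub> s) \<le> cox_length W' S' ?v"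
    then have "s \<in> set (right_refls W' vs)"
      using sup.strong_exchange[of s vs] l lists_sub gens_sub sup.gen_reflection
      by (auto simp: word_prod_eq mult_eq)
    then have "s \<in> set (right_refls W vs)" using l right_refls_eq by simp
    from sub.right_refls_delete[OF l(1) this]
    obtain us where us: "set us \<subseteq> set vs" "length vs = Suc (length us)"
      "word_prod W us = ?v \<otimes>\<^bsub>W\<^esub> s"
      by blast
    then have "cox_length W S (?v \<otimes>\<^bsub>W\<^esub> s) \<le> length us"
      using sub.cox_length_le[of us] l by auto
    then show False using vs snoc.prems us by simp
  qed
  moreover have "cox_length W' S' (?v \<otimes>\<^bsub>W\<^esub> s) \<le> length (vs @ [s])"
    using sup.cox_length_le[of "vs @ [s]"] l lists_sub[of "vs @ [s]"] word_prod_eq[of "vs @ [s]"]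
    by simp
  ultimately show ?case using vs len by simp
qed

section \<open>Lengths, descents and reduced words in the subgroup\<close>

lemma length_eq: "x \<in> carrier W \<Longrightarrow> cox_length W' S' x = cox_length W S x"
  using sub.reduced_word_ex[of x] reduced_length by (auto simp: reduced_word_def)

text \<open>A generator of \<open>W'\<close> has length one there, hence also in \<open>W\<close>,
  so its reduced word over \<open>S\<close> is a single letter.\<close>

lemma gens_inter:
  assumes "s \<in> S'" "s \<in> carrier W"
  shows "s \<in> S"
proof -
  obtain us where us: "reduced_word W S s us" using sub.reduced_word_ex assms by blast
  then have "length us = 1"
    using length_eq[of s] sup.cox_length_gen[of s] assms by (simp add: reduced_word_def)
  then obtain a where "us = [a]" by (auto simp: length_Suc_conv)
  then show ?thesis using us by (auto simp: reduced_word_def)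
qed

text \<open>Exchange in \<open>W'\<close>, applied to a word for z over \<open>S\<close>, finds t
  among the entries of that word; they are the same in \<open>W\<close>, where they are
  reflections.\<close>

lemma descent_reflection:
  assumes "z \<in> carrier W" "t \<in> reflections W' S'"
    "cox_length W' S' (z \<otimes>\<^bsub>W'\<^esub> t) \<le> cox_length W' S' z"
  shows "t \<in> reflections W S"
proof -
  obtain us where us: "us \<in> lists S" "word_prod W us = z"
    using assms sub.carrier_word by blast
  then have "t \<in> set (right_refls W' us)"
    using sup.strong_exchange[of t us] assms lists_sub[of us] word_prod_eq[of us] by metis
  then show ?thesis
    using sub.right_refls_delete[OF us(1)] right_refls_eq[OF us(1)] by metis
qed

text \<open>The last letter is a descent of the product, so it is a reflection of \<open>W\<close>
  and hence lies in \<open>S\<close>. Removing it leaves a reduced word whose product is again in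
  \<open>W\<close>.\<close>

lemma reduced_word_sub:
  assumes "us \<in> lists S'" "word_prod W' us \<in> carrier W"
    "length us = cox_length W' S' (word_prod W' us)"
  shows "us \<in> lists S"
  using assms
proof (induction us rule: rev_induct)
  case (snoc s vs)
  let ?v = "word_prod W' vs"
  have l: "vs \<in> lists S'" "s \<in> S'" "?v \<in> carrier W'" using snoc.prems by auto
  define z where "z = ?v \<otimes>\<^bsub>W'\<^esub> s"
  have z: "z \<in> carrier W" "length (vs @ [s]) = cox_length W' S' z"
    using snoc.prems l by (auto simp: z_def)
  have v: "z \<otimes>\<^bsub>W'\<^esub> s = ?v" using l by (simp add: z_def sup.m_assoc)
  \<comment> \<open>The product z s of \<open>vs\<close> has length at most that of
    \<open>vs\<close>, which is one less than the length of z.\<close>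
  have "cox_length W' S' (z \<otimes>\<^bsub>W'\<^esub> s) \<le> cox_length W' S' z"
    using v z sup.cox_length_le[of vs] l by simp
  then have s: "s \<in> S"
    using descent_reflection[of z s] z l sup.gen_reflection gens_inter by auto
  then have vW: "?v \<in> carrier W" using v z by (metis mult_eq sub.gen_closed sub.m_closed)
  obtain ws where ws: "reduced_word W' S' ?v ws" using sup.reduced_word_ex l by blast
  have "word_prod W' (ws @ [s]) = z" "ws @ [s] \<in> lists S'"
    using ws l by (auto simp: reduced_word_def z_def)
  then have "length (vs @ [s]) \<le> length (ws @ [s])"
    using sup.cox_length_le[of "ws @ [s]"] z by simp
  then have "length vs = cox_length W' S' ?v"
    using ws sup.cox_length_le[of vs] l by (simp add: reduced_word_def)
  then show ?case using snoc.IH vW l s by simp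
qed simp

text \<open>\<open>hecke_bar_T\<close> picks a reduced word by \<open>SOME\<close>; equal predicates
  make it pick the same word in both groups.\<close>

lemma reduced_word_eq:
  assumes "w \<in> carrier W"
  shows "reduced_word W' S' w = reduced_word W S w"
proof
  fix us
  show "reduced_word W' S' w us = reduced_word W S w us"
    unfolding reduced_word_def
    using assms reduced_word_sub[of us] lists_sub[of us] word_prod_eq[of us] length_eq[of w]
    by metis
qed

section \<open>Bruhat order and Bruhat graph below an element of the subgroup\<close>

lemma edge_eq:
  assumes "z \<in> carrier W"
  shows "bruhat_edge W' S' x z = bruhat_edge W S x z"
proof
  assume "bruhat_edge W' S' x z"
  then obtain t where t: "x \<in> carrier W'" "t \<in> reflections W' S'" "z = x \<otimes>\<^bsub>W'\<^esub> t"
    "cox_length W' S' x < cox_length W' S' z"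
    by (auto simp: bruhat_edge_def)
  \<comment> \<open>Read downwards from z the edge is a descent, which forces t, and with it x = z
    t, into \<open>W\<close>.\<close>
  have x: "z \<otimes>\<^bsub>W'\<^esub> t = x"
    using t by (simp add: sup.m_assoc sup.reflection_square)
  then have tS: "t \<in> reflections W S"
    using descent_reflection[of z t] t assms by simp
  then have xW: "x \<in> carrier W"
    using x assms mult_eq[of z t] sub.m_closed[of z t] by simp
  then have "z = x \<otimes>\<^bsub>W\<^esub> t" using t tS mult_eq[of x t] by simp
  then show "bruhat_edge W S x z"
    unfolding bruhat_edge_def using t(4) tS xW assms length_eq by metis
next
  assume "bruhat_edge W S x z"
  then obtain t where "x \<in> carrier W" "t \<in> reflections W S" "z = x \<otimes>\<^bsub>W\<^esub> t"
    "cox_length W S x < cox_length W S z"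
    by (auto simp: bruhat_edge_def)
  then show "bruhat_edge W' S' x z"
    unfolding bruhat_edge_def
    using assms reflections_sub[of t] carrier_sub[of x] mult_eq[of x t] length_eq
      sub.reflection_closed[of t] by metis
qed

text \<open>Follow a chain in \<open>W'\<close> downwards from y: every edge has its upper end in
  \<open>W\<close>, so it is an edge of \<open>W\<close> and its lower end stays in
  \<open>W\<close>.\<close>

lemma bruhat_le_eq:
  assumes "y \<in> carrier W"
  shows "bruhat_le W' S' x y = bruhat_le W S x y"
proof
  assume "bruhat_le W' S' x y"
  then have "(bruhat_edge W' S')\<^sup>*\<^sup>* x y" by (simp add: bruhat_le_def)
  then have "x \<in> carrier W \<and> (bruhat_edge W S)\<^sup>*\<^sup>* x y"
  proof (induction rule: converse_rtranclp_induct)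
    case (step x z)
    then have "bruhat_edge W S x z" using edge_eq by simp
    with step show ?case using sub.edge_closed by (auto intro: converse_rtranclp_into_rtranclp)
  qed (use assms in simp)
  then show "bruhat_le W S x y" by (simp add: bruhat_le_def)
next
  assume le: "bruhat_le W S x y"
  then have "(bruhat_edge W S)\<^sup>*\<^sup>* x y" by (simp add: bruhat_le_def)
  then have "(bruhat_edge W' S')\<^sup>*\<^sup>* x y"
    by (rule rtranclp_mono[THEN predicate2D, rotated]) (use sub.edge_closed edge_eq in blast)
  then show "bruhat_le W' S' x y" using le carrier_sub by (simp add: bruhat_le_def)
qed

lemma bruhat_le_closed: "y \<in> carrier W \<Longrightarrow> bruhat_le W S x y \<Longrightarrow> x \<in> carrier W"
  by (simp add: bruhat_le_def)

lemma bruhat_interval_eq: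
  assumes "y \<in> carrier W"
  shows "bruhat_interval W' S' x y = bruhat_interval W S x y"
proof -
  \<comment> \<open>The comparison of x with z has its upper end z in \<open>W\<close> because z
    lies below y.\<close>
  have "bruhat_le W S z y \<Longrightarrow> bruhat_le W' S' x z = bruhat_le W S x z" for z
    using bruhat_le_eq bruhat_le_closed[OF assms] by blast
  then show ?thesis
    unfolding bruhat_interval_def using bruhat_le_eq[OF assms] by blast
qed

text \<open>Inducing on the interval discards the vertices outside \<open>W\<close>, and the
  remaining arcs end in \<open>W\<close>. The graphs are literally equal, so cubulations transfer
  directly.\<close>

lemma bruhat_interval_graph_eq:
  assumes "y \<in> carrier W"
  shows "bruhat_interval_graph W' S' x y = bruhat_interval_graph W S x y"
proof -
  have "z \<in> carrier W" if "z \<in> bruhat_interval W S x y" for z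
    using that assms bruhat_le_closed by (auto simp: bruhat_interval_def)
  then show ?thesis
    unfolding bruhat_interval_graph_def bruhat_interval_eq[OF assms]
    by (auto simp: bruhat_graph_def with_proj_def induce_subgraph_def edge_eq)
qed


end


section \<open>Hecke algebras\<close>

text \<open>Bounds on supports confine the computation to basis elements indexed by
  \<open>W\<close>, where the multiplication rules of the two groups agree.\<close>

lemma keys_hecke_scale: "Poly_Mapping.keys (hecke_scale c h) \<subseteq> Poly_Mapping.keys h"
  by (auto simp: hecke_scale_def in_keys_iff Poly_Mapping.map.rep_eq when_def)

lemma keys_hecke_T: "Poly_Mapping.keys (hecke_T w) \<subseteq> {w}"
  by (simp add: hecke_T_def)

context coxeter_pair
begin

text \<open>The rule depends only on the product of w and s and on a comparison of lengths.\<close>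

lemma T_mult_gen_eq:
  "w \<in> carrier W \<Longrightarrow> s \<in> S \<Longrightarrow> hecke_T_mult_gen W' S' w s = hecke_T_mult_gen W S w s"
  by (simp add: hecke_T_mult_gen_def mult_eq length_eq)

lemma keys_T_mult_gen: "Poly_Mapping.keys (hecke_T_mult_gen W S w s) \<subseteq> {w, w \<otimes>\<^bsub>W\<^esub> s}"
proof -
  have "Poly_Mapping.keys (hecke_scale c (hecke_T v)) \<subseteq> {v}" for c and v :: 'a
    using keys_hecke_scale keys_hecke_T by (rule subset_trans)
  then have "Poly_Mapping.keys (hecke_scale c (hecke_T v) + hecke_scale d (hecke_T u)) \<subseteq> {u, v}"
    for c d and u v :: 'a
    using keys_add[of "hecke_scale c (hecke_T v)" "hecke_scale d (hecke_T u)"] by blast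
  then show ?thesis
    using keys_hecke_T[of "w \<otimes>\<^bsub>W\<^esub> s"] unfolding hecke_T_mult_gen_def by auto
qed

lemma mult_gen_eq:
  assumes "Poly_Mapping.keys h \<subseteq> carrier W" "s \<in> S"
  shows "hecke_mult_gen W' S' h s = hecke_mult_gen W S h s"
  unfolding hecke_mult_gen_def by (rule sum.cong) (use assms T_mult_gen_eq in auto)

lemma keys_mult_gen:
  assumes "Poly_Mapping.keys h \<subseteq> carrier W" "s \<in> S"
  shows "Poly_Mapping.keys (hecke_mult_gen W S h s) \<subseteq> carrier W"
proof -
  have "Poly_Mapping.keys (hecke_scale c (hecke_T_mult_gen W S w s)) \<subseteq> carrier W"
    if "w \<in> Poly_Mapping.keys h" for c w
  proof -
    have "{w, w \<otimes>\<^bsub>W\<^esub> s} \<subseteq> carrier W" using assms that by auto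
    then show ?thesis
      by (intro subset_trans[OF keys_hecke_scale] subset_trans[OF keys_T_mult_gen])
  qed
  then show ?thesis
    unfolding hecke_mult_gen_def by (intro subset_trans[OF keys_sum] UN_least)
qed

lemma mult_gen_inv_eq:
  assumes "Poly_Mapping.keys h \<subseteq> carrier W" "s \<in> S"
  shows "hecke_mult_gen_inv W' S' h s = hecke_mult_gen_inv W S h s"
  using assms by (simp add: hecke_mult_gen_inv_def mult_gen_eq)

lemma keys_mult_gen_inv:
  assumes "Poly_Mapping.keys h \<subseteq> carrier W" "s \<in> S"
  shows "Poly_Mapping.keys (hecke_mult_gen_inv W S h s) \<subseteq> carrier W"
  unfolding hecke_mult_gen_inv_def
  by (intro subset_trans[OF keys_diff] Un_least subset_trans[OF keys_hecke_scale] keys_mult_gen assms)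

text \<open>Each factor keeps the support in \<open>W\<close>, so the next one acts alike in both
  groups; the induction generalizes over the accumulator \<open>h\<close>.\<close>

lemma foldl_mult_gen_inv_eq:
  assumes "Poly_Mapping.keys h \<subseteq> carrier W" "us \<in> lists S"
  shows "foldl (hecke_mult_gen_inv W' S') h us = foldl (hecke_mult_gen_inv W S) h us"
  using assms by (induction us arbitrary: h) (auto simp: mult_gen_inv_eq keys_mult_gen_inv)

lemma bar_T_eq:
  assumes "w \<in> carrier W"
  shows "hecke_bar_T W' S' w = hecke_bar_T W S w"
proof -
  \<comment> \<open>A reduced word exists, so the chosen one really is reduced and therefore a word
    over \<open>S\<close>.\<close>
  have "reduced_word W S w (SOME us. reduced_word W S w us)"
    using sub.reduced_word_ex[OF assms] someI by metis
  then have "(SOME us. reduced_word W S w us) \<in> lists S" by (simp add: reduced_word_def)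
  moreover have "Poly_Mapping.keys (hecke_T \<one>\<^bsub>W\<^esub>) \<subseteq> carrier W"
    using keys_hecke_T[of "\<one>\<^bsub>W\<^esub>"] sub.one_closed by blast
  ultimately show ?thesis
    unfolding hecke_bar_T_def using foldl_mult_gen_inv_eq assms
    by (simp add: reduced_word_eq one_eq)
qed

lemma bar_eq:
  assumes "Poly_Mapping.keys h \<subseteq> carrier W"
  shows "hecke_bar W' S' h = hecke_bar W S h"
  unfolding hecke_bar_def by (rule sum.cong) (use assms bar_T_eq in auto)

section \<open>Kazhdan--Lusztig elements and polynomials\<close>

lemma kl_element_eq: "y \<in> carrier W \<Longrightarrow> kl_element W' S' y P = kl_element W S y P"
  by (simp add: kl_element_def length_eq bruhat_le_eq)

lemma keys_kl_element:
  assumes "y \<in> carrier W"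
  shows "Poly_Mapping.keys (kl_element W S y P) \<subseteq> carrier W"
proof -
  have "Poly_Mapping.keys (hecke_scale (poly_in_q (P x)) (hecke_T x)) \<subseteq> {x}" for x
    using keys_hecke_scale keys_hecke_T by (rule subset_trans)
  then have "Poly_Mapping.keys (\<Sum>x\<in>{x. bruhat_le W S x y}. hecke_scale (poly_in_q (P x)) (hecke_T x))
      \<subseteq> {x. bruhat_le W S x y}"
    by (intro subset_trans[OF keys_sum]) blast
  also have "\<dots> \<subseteq> carrier W" using bruhat_le_closed[OF assms] by blast
  finally show ?thesis
    unfolding kl_element_def by (rule subset_trans[OF keys_hecke_scale])
qed

text \<open>The order below y, the lengths there and the bar image of the candidate element agree,
  so each defining condition on P is the same in both groups.\<close>

lemma kl_family_eq:
  assumes "y \<in> carrier W"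
  shows "kl_family W' S' y = kl_family W S y"
proof
  fix P
  have "bruhat_le W S x y \<Longrightarrow> cox_length W' S' x = cox_length W S x" for x
    using bruhat_le_closed[OF assms] length_eq by blast
  then show "kl_family W' S' y P = kl_family W S y P"
    unfolding kl_family_def bruhat_le_eq[OF assms] kl_element_eq[OF assms] length_eq[OF assms]
      bar_eq[OF keys_kl_element[OF assms]]
    by auto
qed

text \<open>\<open>THE\<close> is applied to equal predicates, so the values agree at every x,
  including those outside \<open>W\<close>.\<close>

lemma kl_poly_eq: "y \<in> carrier W \<Longrightarrow> kl_poly W' S' x y = kl_poly W S x y"
  by (simp add: kl_poly_def kl_family_eq)

end

theorem proposition4p4:
  fixes W :: "('a, 'b) monoid_scheme" and W' :: "('a, 'c) monoid_scheme"
    and S S' :: "'a set" and y :: 'a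
  assumes "coxeter_system W S"
    and "y \<in> carrier W"
    and "\<forall>x\<in>carrier W. bruhat_le W S x y \<longrightarrow> kl_poly W S x y = 1"
    and "\<not> can_be_cubulated (bruhat_interval_graph W S \<one>\<^bsub>W\<^esub> y)"
    and "coxeter_system W' S'"
    and "coxeter_subsystem W S W' S'"
  shows "(\<forall>x'\<in>carrier W'. bruhat_le W' S' x' y \<longrightarrow> kl_poly W' S' x' y = 1) \<and>
    \<not> can_be_cubulated (bruhat_interval_graph W' S' \<one>\<^bsub>W'\<^esub> y) \<and>
    \<not> (\<forall>z\<in>carrier W'.
         (\<forall>x\<in>carrier W'. bruhat_le W' S' x z \<longrightarrow> kl_poly W' S' x z = 1) \<longrightarrow>
         can_be_cubulated (bruhat_interval_graph W' S' \<one>\<^bsub>W'\<^esub> z))"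
proof -
  interpret coxeter_pair W S W' S'
    using assms by (simp add: coxeter_pair_def coxeter_def coxeter_pair_axioms_def)
  \<comment> \<open>Everything below y in \<open>W'\<close> lies in \<open>W\<close>, where the
    assumption on the polynomials applies.\<close>
  have "\<forall>x'\<in>carrier W'. bruhat_le W' S' x' y \<longrightarrow> kl_poly W' S' x' y = 1"
    using assms(2,3) bruhat_le_eq bruhat_le_closed kl_poly_eq by metis
  moreover have "\<not> can_be_cubulated (bruhat_interval_graph W' S' \<one>\<^bsub>W'\<^esub> y)"
    using assms(2,4) by (simp add: bruhat_interval_graph_eq one_eq)
  \<comment> \<open>The element y itself refutes the implication for all z.\<close>
  ultimately show ?thesis using assms(2) carrier_sub by blast
qed

end
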